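(* Let $0<\epsilon<1$. Given an undirected graph $G=(V,E)$ on $m$ edges and $n$ vertices with non-negative edge weights (with ratio between largest and smallest edge weight at most $\mathrm{poly}(n)$) and a set of terminals $T\subseteq V$ with $|T|\ge2$, the following algorithm computes a $(1+\epsilon)$-approximate minimum Steiner cut for $T$ with probability at least $1-1/n$ in $\tilde{O}(m)$ time. Algorithm: for each $i=1,\dots,\lceil\log_2|T|\rceil$ and each $j=1,\dots,\lceil\log_{8/7}n\rceil$, draw independently a random subset $T_{ij}\subseteq T$ in which every vertex $t\in T$ appears independently with probability $1/2^i$, and use the isolating-cuts subroutine described in the context to find $(1+\epsilon)$-approximate minimum isolating cuts $\mathcal S_{ij}=\{S_t:t\in T_{ij}\}$ for the terminal set $T_{ij}$. Return a set $S$ minimizing $\delta(S)$ over all $S\in\mathcal S_{ij}$, $i\in\{1,\dots,\lceil\log_2|T|\rceil\}$, $j\in\{1,\dots,\lceil\log_{8/7}n\rceil\}$.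
   Context: $\tilde O$ hides $\mathrm{polylog}(n)$ factors ($\epsilon$ is treated as a constant). $\delta(S)$ is the total weight of edges between $S$ and $V\setminus S$. A Steiner cut for $T$ is a set $\emptyset\subset S\subset V$ with $\emptyset\subset S\cap T\subset T$ (strict inclusions); its value is $\delta(S)$. A minimum Steiner cut is a Steiner cut of minimum value, and a $(1+\epsilon)$-approximate minimum Steiner cut is a Steiner cut whose value is at most $(1+\epsilon)$ times the minimum. Isolating-cuts subroutine: for a terminal set $R\subseteq V$, an isolating cut for $t\in R$ is a set $\emptyset\subset S\subset V$ with $R\cap S=\{t\}$; a $(1+\epsilon)$-approximate minimum isolating cut for $t$ is an isolating cut for $t$ of value at most $(1+\epsilon)$ times the minimum value of an isolating cut for $t$. The subroutine takes $G$ and $R$ and, in $\tilde O(m/\epsilon^3)$ time, outputs for every $t\in R$ a $(1+\epsilon)$-approximate minimum isolating cut $S_t$; the sets $S_t$ are disjoint, and, with $\gamma=\epsilon/(4\lceil\log_2|R|\rceil)$, for each $t\in R$ there is a feasible flow (respecting capacities equal to the edge weights) with zero net flow out of every vertex of $S_t\setminus\{t\}$ that sends at least $\frac1{1+\gamma}$ times the weight of every edge between $S_t$ and $V\setminus S_t$ in the direction from $S_t$ to $V\setminus S_t$.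
   Formalization: Rounds with |T_ij|≤1 are skipped (γ is undefined for |R|=1, and a non-Steiner cut could be returned). The time bound is Õ(m+n) for all graphs and Õ(m) when n≤2m, since Õ(m) is impossible for edgeless graphs; the subroutine's time is likewise Õ((m+n)/ε³). *)

theory Defs
  imports "HOL-Probability.Probability"
begin

section \<open>Weighted undirected graphs, cuts and flows\<close>

record 'a wgraph =
  verts :: "'a set"
  edges :: "'a set set"
  weight :: "'a set \<Rightarrow> real"

definition weighted_graph :: "'a wgraph \<Rightarrow> bool" where
  "weighted_graph G \<longleftrightarrow>
     finite (verts G) \<and>
     (\<forall>e\<in>edges G. e \<subseteq> verts G \<and> card e = 2) \<and>
     (\<forall>e\<in>edges G. weight G e \<ge> 0)"

text \<open>The largest weight is at most \<open>n ^ c\<close> times the smallest one, written without division.\<close>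

definition weight_ratio_le_poly :: "nat \<Rightarrow> 'a wgraph \<Rightarrow> bool" where
  "weight_ratio_le_poly c G \<longleftrightarrow>
     (\<forall>e\<in>edges G. \<forall>e'\<in>edges G. weight G e \<le> real (card (verts G)) ^ c * weight G e')"

definition cut_weight :: "'a wgraph \<Rightarrow> 'a set \<Rightarrow> real" where
  "cut_weight G S = (\<Sum>e | e \<in> edges G \<and> e \<inter> S \<noteq> {} \<and> e \<inter> (verts G - S) \<noteq> {}. weight G e)"

definition steiner_cut :: "'a wgraph \<Rightarrow> 'a set \<Rightarrow> 'a set \<Rightarrow> bool" where
  "steiner_cut G T S \<longleftrightarrow> {} \<subset> S \<and> S \<subset> verts G \<and> {} \<subset> S \<inter> T \<and> S \<inter> T \<subset> T"

definition approx_min_steiner_cut :: "real \<Rightarrow> 'a wgraph \<Rightarrow> 'a set \<Rightarrow> 'a set \<Rightarrow> bool" where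
  "approx_min_steiner_cut \<epsilon> G T S \<longleftrightarrow>
     steiner_cut G T S \<and>
     cut_weight G S \<le> (1 + \<epsilon>) * Min (cut_weight G ` {S'. steiner_cut G T S'})"

definition isolating_cut :: "'a wgraph \<Rightarrow> 'a set \<Rightarrow> 'a \<Rightarrow> 'a set \<Rightarrow> bool" where
  "isolating_cut G R t S \<longleftrightarrow> {} \<subset> S \<and> S \<subset> verts G \<and> R \<inter> S = {t}"

definition approx_min_isolating_cut :: "real \<Rightarrow> 'a wgraph \<Rightarrow> 'a set \<Rightarrow> 'a \<Rightarrow> 'a set \<Rightarrow> bool" where
  "approx_min_isolating_cut \<epsilon> G R t S \<longleftrightarrow>
     isolating_cut G R t S \<and>
     cut_weight G S \<le> (1 + \<epsilon>) * Min (cut_weight G ` {S'. isolating_cut G R t S'})"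

text \<open>\<open>f u v\<close> is the signed amount of flow sent from \<open>u\<close> to \<open>v\<close> along the edge \<open>{u, v}\<close>.\<close>

definition feasible_flow :: "'a wgraph \<Rightarrow> ('a \<Rightarrow> 'a \<Rightarrow> real) \<Rightarrow> bool" where
  "feasible_flow G f \<longleftrightarrow>
     (\<forall>u v. f u v = - f v u) \<and>
     (\<forall>u v. \<bar>f u v\<bar> \<le> (if {u, v} \<in> edges G then weight G {u, v} else 0))"

definition net_flow_out :: "'a wgraph \<Rightarrow> ('a \<Rightarrow> 'a \<Rightarrow> real) \<Rightarrow> 'a \<Rightarrow> real" where
  "net_flow_out G f v = (\<Sum>u\<in>verts G. f v u)"

definition almost_saturated_from :: "real \<Rightarrow> 'a wgraph \<Rightarrow> 'a \<Rightarrow> 'a set \<Rightarrow> bool" where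
  "almost_saturated_from \<gamma> G t S \<longleftrightarrow>
     (\<exists>f. feasible_flow G f \<and>
          (\<forall>v\<in>S - {t}. net_flow_out G f v = 0) \<and>
          (\<forall>u\<in>S. \<forall>v\<in>verts G - S.
             {u, v} \<in> edges G \<longrightarrow> f u v \<ge> 1 / (1 + \<gamma>) * weight G {u, v}))"


section \<open>Randomized computations with running time\<close>

text \<open>
  A computation is a distribution over pairs of a result and the time taken; binding uses fresh
  randomness and adds up times. The cost model is a unit-cost real RAM up to constant factors:
  every loop iteration is charged 1, which pays for a constant number of arithmetic operations,
  comparisons, array accesses and pointer assignments; all other costs are charged explicitly.
\<close>

type_synonym 'a timed = "('a \<times> nat) pmf"

definition ret :: "'a \<Rightarrow> 'a timed" where
  "ret x = return_pmf (x, 0)"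

definition bind_timed :: "'a timed \<Rightarrow> ('a \<Rightarrow> 'b timed) \<Rightarrow> 'b timed"
    (infixl "\<bind>\<^sub>t" 54) where
  "m \<bind>\<^sub>t f = bind_pmf m (\<lambda>(x, c). map_pmf (\<lambda>(y, d). (y, c + d)) (f x))"

definition tick :: "nat \<Rightarrow> unit timed" where
  "tick c = return_pmf ((), c)"

primrec for_each :: "'b list \<Rightarrow> ('b \<Rightarrow> 's \<Rightarrow> 's timed) \<Rightarrow> 's \<Rightarrow> 's timed" where
  "for_each [] f s = ret s"
| "for_each (x # xs) f s = tick 1 \<bind>\<^sub>t (\<lambda>_. f x s \<bind>\<^sub>t for_each xs f)"

text \<open>The order in which a stored finite set is traversed is arbitrary but fixed.\<close>

definition enum_list :: "'a set \<Rightarrow> 'a list" where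
  "enum_list A = (SOME xs. distinct xs \<and> set xs = A)"


section \<open>The isolating-cuts subroutine\<close>

text \<open>
  The subroutine may itself be randomized, but its guarantees hold for every possible outcome.
  At least two terminals are required: otherwise \<open>\<lceil>log 2 |R|\<rceil> = 0\<close> and \<open>\<gamma>\<close> is undefined.
  The time bound is \<open>m + n\<close>, which for graphs without isolated vertices is the same as \<open>m\<close>
  up to a constant factor.
\<close>

definition isolating_cuts_output ::
    "real \<Rightarrow> 'a wgraph \<Rightarrow> 'a set \<Rightarrow> ('a \<Rightarrow> 'a set) \<Rightarrow> bool" where
  "isolating_cuts_output \<epsilon> G R S \<longleftrightarrow>
     (\<forall>t\<in>R. approx_min_isolating_cut \<epsilon> G R t (S t)) \<and>
     disjoint_family_on S R \<and>
     (\<forall>t\<in>R. almost_saturated_from (\<epsilon> / (4 * of_int \<lceil>log 2 (real (card R))\<rceil>)) G t (S t))"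

definition isolating_cuts_subroutine ::
    "real \<Rightarrow> nat \<Rightarrow> ('a wgraph \<Rightarrow> 'a set \<Rightarrow> ('a \<Rightarrow> 'a set) timed) \<Rightarrow> bool" where
  "isolating_cuts_subroutine \<epsilon> c icuts \<longleftrightarrow>
     (\<exists>C k. \<forall>G R.
        weighted_graph G \<and> weight_ratio_le_poly c G \<and> R \<subseteq> verts G \<and> card R \<ge> 2 \<longrightarrow>
        (\<forall>(S, time)\<in>set_pmf (icuts G R).
           isolating_cuts_output \<epsilon> G R S \<and>
           real time \<le> C * real (card (edges G) + card (verts G))
                         * log 2 (real (card (verts G))) ^ k / \<epsilon> ^ 3))"


section \<open>The algorithm\<close>

text \<open>A Bernoulli trial with parameter \<open>1 / 2 ^ i\<close> is charged \<open>i\<close>: it is \<open>i\<close> fair coin flips.\<close>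

definition coin :: "nat \<Rightarrow> bool timed" where
  "coin i = map_pmf (\<lambda>b. (b, i)) (bernoulli_pmf (1 / 2 ^ i))"

definition sample_terminals :: "nat \<Rightarrow> 'a set \<Rightarrow> 'a list timed" where
  "sample_terminals i T =
     for_each (enum_list T) (\<lambda>t R. coin i \<bind>\<^sub>t (\<lambda>b. ret (if b then t # R else R))) []"

text \<open>
  The weight of the cut \<open>S\<close> is obtained by scanning the adjacency lists of the vertices of \<open>S\<close>.
  The initial charge is for marking the vertices of \<open>S\<close> and clearing the marks again, so that
  each test \<open>e \<subseteq> S\<close> takes constant time.
\<close>

definition compute_cut_weight :: "'a wgraph \<Rightarrow> 'a set \<Rightarrow> real timed" where
  "compute_cut_weight G S =
     tick (2 * card S) \<bind>\<^sub>t (\<lambda>_.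
     for_each (enum_list S) (\<lambda>v.
       for_each (enum_list {e \<in> edges G. v \<in> e}) (\<lambda>e a.
         ret (if e \<subseteq> S then a else a + weight G e))) 0)"

text \<open>The state of the main loops is the best set found so far together with its cut weight.\<close>

definition update_best ::
    "'a wgraph \<Rightarrow> 'a set \<Rightarrow> ('a set \<times> real) option \<Rightarrow> ('a set \<times> real) option timed" where
  "update_best G S best =
     compute_cut_weight G S \<bind>\<^sub>t (\<lambda>d.
     ret (case best of
            None \<Rightarrow> Some (S, d)
          | Some (S', d') \<Rightarrow> if d < d' then Some (S, d) else Some (S', d')))"

definition steiner_round ::
    "('a wgraph \<Rightarrow> 'a set \<Rightarrow> ('a \<Rightarrow> 'a set) timed) \<Rightarrow> 'a wgraph \<Rightarrow> 'a set \<Rightarrow> nat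
       \<Rightarrow> ('a set \<times> real) option \<Rightarrow> ('a set \<times> real) option timed" where
  "steiner_round icuts G T i best =
     sample_terminals i T \<bind>\<^sub>t (\<lambda>R.
     tick (length R) \<bind>\<^sub>t (\<lambda>_.
     if length R < 2 then ret best
     else icuts G (set R) \<bind>\<^sub>t (\<lambda>S. for_each R (\<lambda>t. update_best G (S t)) best)))"

text \<open>
  The result is \<open>None\<close> if no set was ever produced. The first charge is for counting \<open>V\<close> and \<open>T\<close>
  and computing the loop bounds by repeated multiplication, the last one for writing the output.
\<close>

definition approx_steiner_cut_alg ::
    "('a wgraph \<Rightarrow> 'a set \<Rightarrow> ('a \<Rightarrow> 'a set) timed) \<Rightarrow> 'a wgraph \<Rightarrow> 'a set
       \<Rightarrow> 'a set option timed" where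
  "approx_steiner_cut_alg icuts G T =
     (let I = nat \<lceil>log 2 (real (card T))\<rceil>;
          J = nat \<lceil>log (8 / 7) (real (card (verts G)))\<rceil>
      in tick (card (verts G) + card T + I + J) \<bind>\<^sub>t (\<lambda>_.
         for_each [1..<I + 1] (\<lambda>i.
           for_each [1..<J + 1] (\<lambda>j. steiner_round icuts G T i)) None \<bind>\<^sub>t (\<lambda>best.
         tick (card (verts G)) \<bind>\<^sub>t (\<lambda>_.
         ret (map_option fst best)))))"

end

theory Submission
  imports Defs
begin

text \<open>
  Fix a minimum Steiner cut \<open>A\<close> and let \<open>a\<close> and \<open>b\<close> be the numbers of terminals inside and outside \<open>A\<close>;
  passing to the complement, \<open>a \<le> b\<close>. If a sample \<open>R\<close> contains exactly one terminal \<open>t\<close> of \<open>A\<close> and at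
  least one terminal outside, then \<open>A\<close> is an isolating cut for \<open>t\<close>, so the subroutine returns a set of
  weight at most \<open>(1 + \<epsilon>)\<close> times the optimum; and every set it ever returns is a Steiner cut, because
  \<open>R\<close> has at least two elements. For the scale \<open>i\<close> with \<open>2 ^ i \<le> a < 2 ^ (i + 1)\<close> (or \<open>i = 1\<close> if
  \<open>a = 1\<close>) such a sample occurs with probability at least \<open>1 / 8\<close>, hence all the rounds with this \<open>i\<close>
  fail with probability at most \<open>(7 / 8) ^ J \<le> 1 / n\<close>. For the running time, the sets returned in one
  round are disjoint, so that evaluating all of them costs \<open>O(m + n)\<close> by the degree sum.
\<close>

section \<open>Reasoning about timed computations\<close>

text \<open>The probability arguments work with this projection and so never see the time
  component.\<close>

definition run :: "'a timed \<Rightarrow> 'a pmf" where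
  "run m = map_pmf fst m"

lemma run_ret [simp]: "run (ret x) = return_pmf x"
  by (simp add: run_def ret_def)

lemma run_tick [simp]: "run (tick c) = return_pmf ()"
  by (simp add: run_def tick_def)

lemma run_coin [simp]: "run (coin i) = bernoulli_pmf (1 / 2 ^ i)"
  by (simp add: run_def coin_def pmf.map_comp o_def)

lemma run_bind [simp]: "run (m \<bind>\<^sub>t f) = run m \<bind> (\<lambda>x. run (f x))"
  by (simp add: run_def bind_timed_def map_bind_pmf bind_map_pmf pmf.map_comp o_def case_prod_unfold)

text \<open>A worst-case Hoare triple over the whole support. Postcondition and time bound travel
  together because later costs depend on facts, such as disjointness, about earlier results.\<close>

definition runs :: "'a timed \<Rightarrow> ('a \<Rightarrow> bool) \<Rightarrow> real \<Rightarrow> bool" where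
  "runs m Q B \<longleftrightarrow> (\<forall>(x, t)\<in>set_pmf m. Q x \<and> real t \<le> B)"

lemma runs_ret: "Q x \<Longrightarrow> runs (ret x) Q 0"
  by (simp add: runs_def ret_def)

lemma runs_tick: "runs (tick c) (\<lambda>_. True) (real c)"
  by (simp add: runs_def tick_def)

lemma runs_coin: "runs (coin i) (\<lambda>_. True) (real i)"
  by (auto simp: runs_def coin_def)

lemma runs_bind:
  assumes "runs m P B1" and "\<And>x. P x \<Longrightarrow> runs (f x) Q B2"
  shows "runs (m \<bind>\<^sub>t f) Q (B1 + B2)"
  using assms by (fastforce simp: runs_def bind_timed_def)

lemma runs_weaken:
  assumes "runs m P B1" and "\<And>x. P x \<Longrightarrow> Q x" and "B1 \<le> B2"
  shows "runs m Q B2"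
  using assms by (fastforce simp: runs_def)

lemma runs_run: "runs m Q B \<Longrightarrow> x \<in> set_pmf (run m) \<Longrightarrow> Q x"
  by (fastforce simp: runs_def run_def)

text \<open>The invariant \<open>I\<close> takes the list of elements still to be processed, so it
  can promise what the remaining iterations will contribute; with nothing left, \<open>I []\<close>
  is the postcondition. The 1 is the charge per iteration.\<close>

lemma runs_for_each:
  assumes "\<And>x xs s. I (x # xs) s \<Longrightarrow> runs (f x s) (I xs) (B x)" and "I xs s"
  shows "runs (for_each xs f s) (I []) (\<Sum>x\<leftarrow>xs. 1 + B x)"
  using assms(2)
proof (induction xs arbitrary: s)
  case Nil
  then show ?case by (simp add: runs_ret)
next
  case (Cons x xs)
  have "runs (for_each (x # xs) f s) (I []) (real 1 + (B x + (\<Sum>x\<leftarrow>xs. 1 + B x)))"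
    unfolding for_each.simps
    by (rule runs_bind[OF runs_tick], rule runs_bind[OF assms(1)[OF Cons.prems]], rule Cons.IH)
  then show ?case by (simp add: algebra_simps)
qed

section \<open>Failure probabilities of sequences and loops\<close>

text \<open>\<open>A\<close> collects the bad intermediate results: only these can lead into
  \<open>B\<close>, each with probability at most \<open>q\<close>.\<close>

lemma measure_bind_pmf_le:
  assumes "0 \<le> q"
    and "\<And>x. x \<in> set_pmf m \<Longrightarrow> measure_pmf.prob (f x) B \<le> (if x \<in> A then q else 0)"
  shows "measure_pmf.prob (bind_pmf m f) B \<le> measure_pmf.prob m A * q"
proof -
  have "emeasure (bind_pmf m f) B = (\<integral>\<^sup>+x. emeasure (f x) B \<partial>m)"
    by simp
  also have "\<dots> \<le> (\<integral>\<^sup>+x. ennreal q * indicator A x \<partial>m)"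
  proof (rule nn_integral_mono_AE, rule AE_pmfI)
    fix x assume "x \<in> set_pmf m"
    from assms(2)[OF this] show "emeasure (f x) B \<le> ennreal q * indicator A x"
      by (auto simp: measure_pmf.emeasure_eq_measure ennreal_leI measure_le_0_iff indicator_def split: if_splits)
  qed
  also have "\<dots> = ennreal q * emeasure m A"
    by (simp add: nn_integral_cmult_indicator)
  also have "\<dots> = ennreal (measure_pmf.prob m A * q)"
    using assms(1) by (simp add: measure_pmf.emeasure_eq_measure ennreal_mult' mult.commute)
  finally show ?thesis
    using assms(1) by (simp add: measure_pmf.emeasure_eq_measure)
qed

text \<open>\<open>P\<close> is a goal that is never lost once reached, and \<open>q\<close> bounds
  the chance of missing it from any state satisfying \<open>I\<close>. Uniformity in the starting
  state takes the place of an explicit independence argument.\<close>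

definition progress :: "('s \<Rightarrow> bool) \<Rightarrow> ('s \<Rightarrow> bool) \<Rightarrow> real \<Rightarrow> ('s \<Rightarrow> 's pmf) \<Rightarrow> bool" where
  "progress I P q f \<longleftrightarrow> (\<forall>s. I s \<longrightarrow>
     (\<forall>s'\<in>set_pmf (f s). I s' \<and> (P s \<longrightarrow> P s')) \<and> measure_pmf.prob (f s) {s. \<not> P s} \<le> q)"

text \<open>The goal is missed at the end only if it was missed after \<open>f\<close>; then
  \<open>g\<close>, using fresh randomness, misses it with probability at most \<open>r\<close> from
  whatever state it starts in.\<close>

lemma progress_bind:
  assumes "progress I P q f" and "progress I P r g" and "0 \<le> r"
  shows "progress I P (q * r) (\<lambda>s. bind_pmf (f s) g)"
  unfolding progress_def
proof (intro allI impI conjI)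
  fix s assume s: "I s"
  show "\<forall>s'\<in>set_pmf (bind_pmf (f s) g). I s' \<and> (P s \<longrightarrow> P s')"
    using assms(1,2) s unfolding progress_def set_bind_pmf UN_iff by blast
  have "measure_pmf.prob (bind_pmf (f s) g) {s. \<not> P s} \<le> measure_pmf.prob (f s) {s. \<not> P s} * r"
  proof (rule measure_bind_pmf_le[OF assms(3)])
    fix x assume "x \<in> set_pmf (f s)"
    with assms(1) s have "I x" unfolding progress_def by blast
    with assms(2) have g: "\<forall>y\<in>set_pmf (g x). P x \<longrightarrow> P y" "measure_pmf.prob (g x) {s. \<not> P s} \<le> r"
      unfolding progress_def by blast+
    show "measure_pmf.prob (g x) {s. \<not> P s} \<le> (if x \<in> {s. \<not> P s} then r else 0)"
    proof (cases "P x")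
      case True
      with g(1) have "measure_pmf.prob (g x) {s. \<not> P s} = 0"
        by (subst measure_pmf_zero_iff) auto
      with True show ?thesis by simp
    qed (use g(2) in simp)
  qed
  also have "\<dots> \<le> q * r"
    using assms(1,3) s unfolding progress_def by (intro mult_right_mono) blast+
  finally show "measure_pmf.prob (bind_pmf (f s) g) {s. \<not> P s} \<le> q * r" .
qed

lemma progress_for_each:
  assumes "\<And>x. x \<in> set xs \<Longrightarrow> progress I P (q x) (\<lambda>s. run (f x s))" and "\<And>x. 0 \<le> q x"
  shows "progress I P (prod_list (map q xs)) (\<lambda>s. run (for_each xs f s))"
  using assms(1)
proof (induction xs)
  case Nil
  then show ?case by (simp add: progress_def)
next
  case (Cons x xs)
  have "0 \<le> prod_list (map q xs)"
    using assms(2) by (induction xs) auto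
  then show ?case
    using Cons by (simp add: bind_return_pmf progress_bind)
qed

section \<open>The probability of isolating a terminal\<close>

text \<open>The quotient of the values at c + 1 and c is (c + 1) (1 - 1/N) / c, which is at most 1
  as soon as c >= N - 1.\<close>

lemma mult_power_decreasing:
  fixes N a c :: nat
  assumes "0 < N" "N \<le> a" "a \<le> c"
  shows "real c * (1 - 1 / N) ^ (c - 1) \<le> real a * (1 - 1 / N) ^ (a - 1)"
  using assms(3)
proof (induction c rule: dec_induct)
  case base
  then show ?case by simp
next
  case (step c)
  have c: "N \<le> c" "0 < c" using step assms by auto
  have "real (Suc c) * (1 - 1 / N) \<le> real c"
    using c assms(1) by (simp add: field_simps)
  moreover have "(1 - 1 / real N) ^ (c - 1) \<ge> 0" using assms(1) by simp
  ultimately have "real (Suc c) * (1 - 1 / N) * (1 - 1 / N) ^ (c - 1) \<le> real c * (1 - 1 / N) ^ (c - 1)"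
    by (rule mult_right_mono)
  moreover have "(1 - 1 / real N) ^ (Suc c - 1) = (1 - 1 / N) * (1 - 1 / N) ^ (c - 1)"
    using c by (cases c) auto
  ultimately show ?case using step.IH by (simp add: mult.assoc)
qed

text \<open>The sequence increases, since (1 - x/2)^2 >= 1 - x for x = 1/2^i; its value at i = 2 is
  (3/4)^4 = 81/256.\<close>

lemma power_two_power_ge:
  assumes "2 \<le> i"
  shows "81 / 256 \<le> (1 - 1 / 2 ^ i :: real) ^ 2 ^ i"
  using assms
proof (induction i rule: dec_induct)
  case base
  then show ?case by (simp add: power_divide)
next
  case (step i)
  have "1 - 1 / 2 ^ i \<le> (1 - 1 / 2 ^ Suc i :: real)\<^sup>2"
    by (simp add: power2_eq_square algebra_simps)
  then have "(1 - 1 / 2 ^ i :: real) ^ 2 ^ i \<le> ((1 - 1 / 2 ^ Suc i)\<^sup>2) ^ 2 ^ i"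
    by (rule power_mono) simp
  then show ?case using step.IH by (simp only: power_Suc power_mult)
qed

text \<open>From 1 - x <= exp(-x) the power is at most 1/e, and e >= 2.\<close>

lemma power_two_power_le:
  assumes "1 \<le> i"
  shows "(1 - 1 / 2 ^ i :: real) ^ 2 ^ i \<le> 1 / 2"
proof -
  have "(1 - 1 / 2 ^ i :: real) ^ 2 ^ i \<le> exp (- (1 / 2 ^ i)) ^ 2 ^ i"
    using exp_ge_add_one_self[of "- (1 / 2 ^ i)"] by (intro power_mono) auto
  also have "\<dots> = inverse (exp 1)"
    by (subst exp_of_nat_mult[symmetric]) (simp add: exp_minus)
  also have "\<dots> \<le> 1 / 2"
    using exp_ge_add_one_self[of 1] by (simp add: field_simps)
  finally show ?thesis .
qed

text \<open>
  Write \<open>N = 2 ^ i\<close> and \<open>q = 1 - 1 / N\<close>. Since \<open>a * q ^ (a - 1)\<close> decreases for \<open>a \<ge> N\<close>, the worst case is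
  \<open>a = 2 * N\<close>, which gives at least \<open>2 * y\<^sup>2 * (1 - y)\<close> with \<open>y = q ^ N\<close>. This suffices when
  \<open>81 / 256 \<le> y \<le> 1 / 2\<close>, that is for \<open>i \<ge> 2\<close>.
\<close>

lemma isolation_probability:
  fixes a b :: nat
  assumes "1 \<le> a" "a \<le> b"
  obtains i where "1 \<le> i" "2 ^ i \<le> a + b"
    "1 / 8 \<le> real a * (1 / 2 ^ i) * (1 - 1 / 2 ^ i) ^ (a - 1) * (1 - (1 - 1 / 2 ^ i) ^ b)"
proof (cases "a = 1")
  case True
  \<comment> \<open>For a = 1 the scale i = 1 gives 1/2 times at least 1/2, that is at least
    1/4.\<close>
  have "(1 / 2 :: real) ^ b \<le> (1 / 2) ^ 1"
    using assms by (intro power_decreasing) auto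
  with True assms show ?thesis
    by (intro that[of 1]) auto
next
  case False
  obtain i where i: "2 ^ i \<le> a" "a < 2 ^ (i + 1)"
    using ex_power_ivl1[of 2 a] assms by auto
  have i1: "1 \<le> i" using i(2) False assms by (cases i) auto
  define q :: real where "q = 1 - 1 / 2 ^ i"
  define y where "y = q ^ 2 ^ i"
  have q: "0 \<le> q" "q \<le> 1" by (auto simp: q_def)
  have "2 ^ Suc i * q ^ (2 ^ Suc i - 1) \<le> real a * q ^ (a - 1)"
    using mult_power_decreasing[of "2 ^ i" a "2 ^ Suc i"] i by (simp add: q_def)
  then have A: "2 * q ^ (2 ^ Suc i - 1) \<le> real a * (1 / 2 ^ i) * q ^ (a - 1)"
    by (simp add: field_simps)
  \<comment> \<open>This is where a <= b enters: b >= a >= 2^i.\<close>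
  have B: "1 - y \<le> 1 - q ^ b"
    using i assms q unfolding y_def by (simp add: power_decreasing)
  have y: "0 \<le> y" "y \<le> 1 / 2"
    using power_two_power_le[OF i1] q by (auto simp: y_def q_def)
  have "1 / 8 \<le> 2 * q ^ (2 ^ Suc i - 1) * (1 - y)"
  proof (cases "i = 1")
    case True
    \<comment> \<open>Here q = 1/2 and y = 1/4, so the value is 3/16.\<close>
    then show ?thesis by (simp add: y_def q_def eval_nat_numeral)
  next
    case False
    then have y': "81 / 256 \<le> y" using power_two_power_ge[of i] i1 by (simp add: y_def q_def)
    \<comment> \<open>By concavity y (1 - y) is smallest at an end of [81/256, 1/2], namely at
      81/256, where it exceeds 1/5. This is barely enough: 81/256 times 1/5 is just above 1/16, and
      the factor 2 yields 1/8.\<close>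
    have "0 \<le> (y - 81 / 256) * (1 / 2 - y)" using y y' by simp
    then have "1 / 5 \<le> y * (1 - y)" using y' by (simp add: field_simps)
    then have "(81 / 256) * (1 / 5) \<le> y * (y * (1 - y))" using y' by (intro mult_mono) auto
    moreover have "y * y \<le> q ^ (2 ^ Suc i - 1)"
    proof -
      have "y * y = q ^ (2 ^ Suc i)" by (simp add: y_def mult_2 power_add)
      also have "\<dots> \<le> q ^ (2 ^ Suc i - 1)" using q by (intro power_decreasing) auto
      finally show ?thesis .
    qed
    then have "y * y * (1 - y) \<le> q ^ (2 ^ Suc i - 1) * (1 - y)"
      using y by (intro mult_right_mono) auto
    ultimately show ?thesis by (simp add: algebra_simps)
  qed
  also have "\<dots> \<le> real a * (1 / 2 ^ i) * q ^ (a - 1) * (1 - q ^ b)"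
    using A B y q by (intro mult_mono[OF A]) auto
  finally show ?thesis
    using that[of i] i i1 unfolding q_def by auto
qed

section \<open>The distribution and cost of a random sample\<close>

lemma enum_list:
  assumes "finite A"
  shows "distinct (enum_list A)" "set (enum_list A) = A"
proof -
  obtain xs where "distinct xs \<and> set xs = A"
    using finite_distinct_list[OF assms] by blast
  then have "distinct (enum_list A) \<and> set (enum_list A) = A"
    unfolding enum_list_def by (rule someI)
  then show "distinct (enum_list A)" "set (enum_list A) = A" by auto
qed

lemma sum_list_enum_list: "finite A \<Longrightarrow> sum_list (map f (enum_list A)) = sum f A"
  by (simp add: enum_list sum_list_distinct_conv_sum_set)

text \<open>Each trial affects exactly one of the two counters, so they are independent binomial
  variables. The initial list \<open>R\<close> is arbitrary because the loop accumulates into it, as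
  the induction requires.\<close>

lemma prob_count_sample:
  fixes p :: real
  assumes "p \<in> {0..1}" and "run m = bernoulli_pmf p"
  shows "map_pmf (\<lambda>R. (length (filter P R), length (filter (\<lambda>x. \<not> P x) R)))
      (run (for_each xs (\<lambda>t R. m \<bind>\<^sub>t (\<lambda>b. ret (if b then t # R else R))) R)) =
    map_pmf (\<lambda>(k, l). (length (filter P R) + k, length (filter (\<lambda>x. \<not> P x) R) + l))
      (pair_pmf (binomial_pmf (length (filter P xs)) p) (binomial_pmf (length (filter (\<lambda>x. \<not> P x) xs)) p))"
proof (induction xs arbitrary: R)
  case Nil
  then show ?case using assms(1) by (simp add: binomial_pmf_0)
next
  case (Cons x xs)
  let ?B = "\<lambda>P. binomial_pmf (length (filter P xs)) p"
  let ?Q = "\<lambda>x. \<not> P x"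
  have "map_pmf (\<lambda>R. (length (filter P R), length (filter ?Q R)))
      (run (for_each (x # xs) (\<lambda>t R. m \<bind>\<^sub>t (\<lambda>b. ret (if b then t # R else R))) R)) =
    bernoulli_pmf p \<bind> (\<lambda>b. map_pmf (\<lambda>(k, l).
       (length (filter P (if b then x # R else R)) + k, length (filter ?Q (if b then x # R else R)) + l))
      (pair_pmf (?B P) (?B ?Q)))"
    by (simp add: assms(2) bind_return_pmf bind_assoc_pmf map_bind_pmf Cons.IH)
  also have "\<dots> = map_pmf (\<lambda>(k, l). (length (filter P R) + k, length (filter ?Q R) + l))
      (pair_pmf (binomial_pmf (length (filter P (x # xs))) p) (binomial_pmf (length (filter ?Q (x # xs))) p))"
  proof (cases "P x")
    case True
    then show ?thesis
      by (simp add: binomial_pmf_Suc[OF assms(1)] map_pmf_def pair_pmf_def bind_assoc_pmf bind_return_pmf,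
          intro arg_cong2[where f = bind_pmf] refl ext) simp
  next
    case False
    \<comment> \<open>The trial for \<open>x\<close> is drawn first but now belongs to the second
      binomial, so it has to be moved past the first one.\<close>
    then show ?thesis
      by (simp add: binomial_pmf_Suc[OF assms(1)] map_pmf_def pair_pmf_def bind_assoc_pmf bind_return_pmf,
          subst bind_commute_pmf[of "bernoulli_pmf p"])
        (intro arg_cong2[where f = bind_pmf] refl ext, simp)
  qed
  finally show ?case .
qed

text \<open>By independence, the chance of exactly one success among the terminals with
  \<open>P\<close> and at least one among the others is the product in the last assumption.
  \<open>P\<close> will be membership in a minimum Steiner cut.\<close>

lemma prob_sample_terminals_isolates:
  assumes "finite T"
    and "1 \<le> card {x \<in> T. P x}"
    and "1 / 8 \<le> real (card {x \<in> T. P x}) * (1 / 2 ^ i) * (1 - 1 / 2 ^ i) ^ (card {x \<in> T. P x} - 1) *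
      (1 - (1 - 1 / 2 ^ i) ^ card {x \<in> T. \<not> P x})"
  shows "measure_pmf.prob (run (sample_terminals i T))
    {R. \<not> (length (filter P R) = 1 \<and> 1 \<le> length (filter (\<lambda>x. \<not> P x) R))} \<le> 7 / 8"
proof -
  let ?p = "1 / 2 ^ i :: real"
  let ?Q = "\<lambda>x. \<not> P x"
  define a b where "a = card {x \<in> T. P x}" and "b = card {x \<in> T. ?Q x}"
  have p: "?p \<in> {0..1}" by auto
  have len: "length (filter P' (enum_list T)) = card {x \<in> T. P' x}" for P'
    using enum_list[OF assms(1)] by (metis distinct_card distinct_filter set_filter)
  define h where "h R = (length (filter P R), length (filter ?Q R))" for R
  have law: "map_pmf h (run (sample_terminals i T)) = pair_pmf (binomial_pmf a ?p) (binomial_pmf b ?p)"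
    using prob_count_sample[OF p run_coin, of P "enum_list T" "[]"]
    by (simp add: sample_terminals_def h_def[abs_def] len a_def b_def case_prod_unfold)
  have one: "measure_pmf.prob (binomial_pmf a ?p) {1} = real a * ?p * (1 - ?p) ^ (a - 1)"
    using p by (subst measure_pmf_single, subst pmf_binomial) auto
  have "measure_pmf.prob (binomial_pmf b ?p) {1..} = 1 - measure_pmf.prob (binomial_pmf b ?p) {0}"
    by (subst measure_pmf.prob_compl[symmetric]) (auto intro!: arg_cong[where f = "measure_pmf.prob _"])
  also have "\<dots> = 1 - (1 - ?p) ^ b"
    using p by (subst measure_pmf_single, subst pmf_binomial) auto
  finally have "measure_pmf.prob (pair_pmf (binomial_pmf a ?p) (binomial_pmf b ?p)) ({1} \<times> {1..})
      = real a * ?p * (1 - ?p) ^ (a - 1) * (1 - (1 - ?p) ^ b)"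
    by (simp add: measure_pmf_prob_product one del: One_nat_def)
  with assms(3) have "1 / 8 \<le> measure_pmf.prob (run (sample_terminals i T)) (h -` ({1} \<times> {1..}))"
    by (simp only: measure_map_pmf[symmetric] law) (simp add: a_def b_def)
  then have "measure_pmf.prob (run (sample_terminals i T)) (- (h -` ({1} \<times> {1..}))) \<le> 7 / 8"
    by (simp add: measure_pmf.prob_compl[of _ "run (sample_terminals i T)", simplified] Compl_eq_Diff_UNIV)
  moreover have "- (h -` ({1} \<times> {1..})) = {R. \<not> (length (filter P R) = 1 \<and> 1 \<le> length (filter ?Q R))}"
    by (auto simp: h_def)
  ultimately show ?thesis by simp
qed

lemma runs_sample_terminals:
  assumes "finite T"
  shows "runs (sample_terminals i T) (\<lambda>R. distinct R \<and> set R \<subseteq> T) (real (card T) * (1 + real i))"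
proof -
  \<comment> \<open>Keeping the unvisited elements in the invariant is what makes the sampled list
    distinct.\<close>
  define I where "I ys R \<longleftrightarrow> distinct (ys @ R) \<and> set (ys @ R) \<subseteq> T" for ys R
  have "runs (for_each (enum_list T) (\<lambda>t R. coin i \<bind>\<^sub>t (\<lambda>b. ret (if b then t # R else R))) []) (I [])
      (\<Sum>x\<leftarrow>enum_list T. 1 + (real i + 0))"
  proof (rule runs_for_each)
    fix x xs R assume "I (x # xs) R"
    then have "I xs (if b then x # R else R)" for b by (auto simp: I_def)
    then show "runs (coin i \<bind>\<^sub>t (\<lambda>b. ret (if b then x # R else R))) (I xs) (real i + 0)"
      by (intro runs_bind[OF runs_coin] runs_ret)
  qed (use enum_list[OF assms] in \<open>auto simp: I_def\<close>)
  then show ?thesis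
    unfolding sample_terminals_def by (rule runs_weaken) (auto simp: I_def sum_list_enum_list assms)
qed

section \<open>Cuts in weighted graphs\<close>

lemma finite_edges: "weighted_graph G \<Longrightarrow> finite (edges G)"
  by (rule finite_subset[of _ "Pow (verts G)"]) (auto simp: weighted_graph_def)

definition degree :: "'a wgraph \<Rightarrow> 'a \<Rightarrow> nat" where
  "degree G v = card {e \<in> edges G. v \<in> e}"

text \<open>The handshake lemma, by double counting incidences.\<close>

lemma sum_degree:
  assumes "weighted_graph G"
  shows "(\<Sum>v\<in>verts G. degree G v) = 2 * card (edges G)"
proof -
  have "(\<Sum>v\<in>verts G. degree G v) = (\<Sum>v\<in>verts G. \<Sum>e | e \<in> edges G \<and> v \<in> e. 1)"
    by (simp add: degree_def)
  also have "\<dots> = (\<Sum>e\<in>edges G. \<Sum>v | v \<in> verts G \<and> v \<in> e. 1)"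
    using assms finite_edges[OF assms] by (intro sum.swap_restrict) (auto simp: weighted_graph_def)
  also have "\<dots> = (\<Sum>e\<in>edges G. 2)"
  proof (rule sum.cong[OF refl])
    fix e assume "e \<in> edges G"
    with assms have "{v \<in> verts G. v \<in> e} = e" "card e = 2"
      by (auto simp: weighted_graph_def)
    then show "(\<Sum>v | v \<in> verts G \<and> v \<in> e. 1) = (2 :: nat)" by simp
  qed
  finally show ?thesis by simp
qed

text \<open>The right-hand side is what the adjacency scan adds up. A crossing edge has exactly one
  endpoint in \<open>S\<close> and is counted once; an edge inside \<open>S\<close> is met twice but
  contributes 0.\<close>

lemma cut_weight_eq_sum_over_vertices:
  assumes "weighted_graph G" and "S \<subseteq> verts G"
  shows "cut_weight G S = (\<Sum>v\<in>S. \<Sum>e | e \<in> edges G \<and> v \<in> e. if e \<subseteq> S then 0 else weight G e)"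
proof -
  have fin: "finite S" "finite (edges G)"
    using assms finite_edges finite_subset by (auto simp: weighted_graph_def)
  have "(\<Sum>v\<in>S. \<Sum>e | e \<in> edges G \<and> v \<in> e. if e \<subseteq> S then 0 else weight G e)
      = (\<Sum>e\<in>edges G. \<Sum>v | v \<in> S \<and> v \<in> e. if e \<subseteq> S then 0 else weight G e)"
    using fin by (rule sum.swap_restrict)
  also have "\<dots> = (\<Sum>e\<in>edges G. if e \<inter> S \<noteq> {} \<and> e \<inter> (verts G - S) \<noteq> {} then weight G e else 0)"
  proof (rule sum.cong[OF refl])
    fix e assume "e \<in> edges G"
    with assms have e: "e \<subseteq> verts G" "card e = 2" by (auto simp: weighted_graph_def)
    then obtain x y where "e = {x, y}" "x \<noteq> y" by (auto simp: card_2_iff)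
    moreover from this have "{v \<in> S. v \<in> e} =
        (if x \<in> S then if y \<in> S then {x, y} else {x} else if y \<in> S then {y} else {})"
      by auto
    ultimately show "(\<Sum>v | v \<in> S \<and> v \<in> e. if e \<subseteq> S then 0 else weight G e)
        = (if e \<inter> S \<noteq> {} \<and> e \<inter> (verts G - S) \<noteq> {} then weight G e else 0)"
      using e(1) by auto
  qed
  also have "\<dots> = cut_weight G S"
    unfolding cut_weight_def using fin(2) by (simp add: sum.inter_filter)
  finally show ?thesis by simp
qed

text \<open>Each vertex of \<open>S\<close> costs 2 for marking and unmarking, 1 for its iteration,
  and its degree for the inner loop.\<close>

lemma runs_compute_cut_weight:
  assumes "weighted_graph G" and "S \<subseteq> verts G"
  shows "runs (compute_cut_weight G S) (\<lambda>d. d = cut_weight G S) (\<Sum>v\<in>S. 3 + real (degree G v))"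
proof -
  define E where "E v = {e \<in> edges G. v \<in> e}" for v
  define w where "w e = (if e \<subseteq> S then 0 else weight G e)" for e
  have fin: "finite S" "finite (E v)" for v
    using assms finite_edges[OF assms(1)] finite_subset by (auto simp: weighted_graph_def E_def)
  have inner: "runs (for_each (enum_list (E v)) (\<lambda>e a. ret (if e \<subseteq> S then a else a + weight G e)) a)
      (\<lambda>d. d = a + sum w (E v)) (real (degree G v))" for v a
  proof -
    define I where "I es d \<longleftrightarrow> d + sum_list (map w es) = a + sum w (E v)" for es d
    have "runs (for_each (enum_list (E v)) (\<lambda>e a. ret (if e \<subseteq> S then a else a + weight G e)) a) (I [])
        (\<Sum>e\<leftarrow>enum_list (E v). 1 + 0)"
      by (rule runs_for_each, rule runs_ret)
        (auto simp: I_def w_def sum_list_enum_list fin split: if_splits)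
    then show ?thesis
      by (rule runs_weaken) (auto simp: I_def sum_list_enum_list fin degree_def E_def[symmetric])
  qed
  \<comment> \<open>The accumulated value plus the contribution of the vertices still to be scanned
    stays constant.\<close>
  define I where "I vs d \<longleftrightarrow> d + (\<Sum>v\<leftarrow>vs. sum w (E v)) = cut_weight G S" for vs d
  have "runs (for_each (enum_list S) (\<lambda>v. for_each (enum_list (E v))
      (\<lambda>e a. ret (if e \<subseteq> S then a else a + weight G e))) 0) (I []) (\<Sum>v\<leftarrow>enum_list S. 1 + real (degree G v))"
  proof (rule runs_for_each)
    fix v vs d assume "I (v # vs) d"
    then show "runs (for_each (enum_list (E v)) (\<lambda>e a. ret (if e \<subseteq> S then a else a + weight G e)) d)
        (I vs) (real (degree G v))"
      by (intro runs_weaken[OF inner]) (auto simp: I_def)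
  next
    show "I (enum_list S) 0"
      unfolding I_def cut_weight_eq_sum_over_vertices[OF assms]
      by (simp add: sum_list_enum_list fin E_def w_def)
  qed
  then have "runs (compute_cut_weight G S) (I [])
      (real (2 * card S) + (\<Sum>v\<leftarrow>enum_list S. 1 + real (degree G v)))"
    unfolding compute_cut_weight_def E_def by (intro runs_bind[OF runs_tick])
  then show ?thesis
    by (rule runs_weaken) (auto simp: I_def sum_list_enum_list fin sum.distrib)
qed

lemma cut_weight_complement: "S \<subseteq> verts G \<Longrightarrow> cut_weight G (verts G - S) = cut_weight G S"
  unfolding cut_weight_def by (intro sum.cong) (auto simp: double_diff)

lemma steiner_cut_complement: "T \<subseteq> verts G \<Longrightarrow> steiner_cut G T S \<Longrightarrow> steiner_cut G T (verts G - S)"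
  unfolding steiner_cut_def by blast

text \<open>A second element of \<open>R\<close> lies outside \<open>S\<close>; with a single
  terminal, \<open>S\<close> could swallow all of \<open>T\<close>.\<close>

lemma isolating_cut_imp_steiner_cut:
  assumes "isolating_cut G R t S" and "R \<subseteq> T" and "2 \<le> card R"
  shows "steiner_cut G T S"
proof -
  have "\<not> R \<subseteq> S"
  proof
    assume "R \<subseteq> S"
    with assms(1) have "R = {t}" by (auto simp: isolating_cut_def)
    with assms(3) show False by simp
  qed
  with assms show ?thesis unfolding isolating_cut_def steiner_cut_def by blast
qed

section \<open>Correctness and running time of the algorithm\<close>

definition valid_best :: "'a wgraph \<Rightarrow> 'a set \<Rightarrow> ('a set \<times> real) option \<Rightarrow> bool" where
  "valid_best G T best \<longleftrightarrow> (\<forall>S d. best = Some (S, d) \<longrightarrow> steiner_cut G T S \<and> d = cut_weight G S)"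

text \<open>The threshold is compared with the stored weight, so a statement about cuts results only
  together with \<open>valid_best\<close>. \<open>None\<close> does not qualify: reaching this goal
  also guarantees an output.\<close>

definition best_within :: "real \<Rightarrow> ('a set \<times> real) option \<Rightarrow> bool" where
  "best_within X best \<longleftrightarrow> (\<exists>S d. best = Some (S, d) \<and> d \<le> X)"

section \<open>A single round of the algorithm\<close>

lemma runs_update_best:
  assumes "weighted_graph G" and "steiner_cut G T S" and "valid_best G T best"
  shows "runs (update_best G S best)
    (\<lambda>b. valid_best G T b \<and> (best_within X best \<or> cut_weight G S \<le> X \<longrightarrow> best_within X b))
    (\<Sum>v\<in>S. 3 + real (degree G v))"
proof -
  have "S \<subseteq> verts G" using assms(2) by (auto simp: steiner_cut_def)
  then have "runs (update_best G S best)
    (\<lambda>b. valid_best G T b \<and> (best_within X best \<or> cut_weight G S \<le> X \<longrightarrow> best_within X b))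
    ((\<Sum>v\<in>S. 3 + real (degree G v)) + 0)"
    unfolding update_best_def using assms(2,3)
    by (intro runs_bind[OF runs_compute_cut_weight[OF assms(1)]] runs_ret)
      (auto simp: valid_best_def best_within_def split: option.splits if_splits)
  then show ?thesis by simp
qed

text \<open>Since the sets \<open>S t\<close> are disjoint, their costs add up to at most the sum of
  3 + degree over all vertices, which is 3n + 2m; the iterations themselves add at most n.\<close>

lemma runs_update_best_loop:
  fixes S :: "'a \<Rightarrow> 'a set"
  assumes G: "weighted_graph G"
    and R: "distinct R" "set R \<subseteq> verts G"
    and S: "\<And>t. t \<in> set R \<Longrightarrow> steiner_cut G T (S t)" "disjoint_family_on S (set R)"
    and "valid_best G T best"
  shows "runs (for_each R (\<lambda>t. update_best G (S t)) best)
    (\<lambda>b. valid_best G T b \<and>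
       (best_within X best \<or> (\<exists>t\<in>set R. cut_weight G (S t) \<le> X) \<longrightarrow> best_within X b))
    (4 * card (verts G) + 2 * card (edges G))"
proof -
  have fin: "finite (verts G)" using G by (simp add: weighted_graph_def)
  define good where "good \<longleftrightarrow> best_within X best \<or> (\<exists>t\<in>set R. cut_weight G (S t) \<le> X)"
  \<comment> \<open>If the threshold is ever to be met, either it is met already or a set meeting it
    is still to come.\<close>
  define I where "I ts b \<longleftrightarrow> set ts \<subseteq> set R \<and> valid_best G T b \<and>
    (good \<longrightarrow> best_within X b \<or> (\<exists>t\<in>set ts. cut_weight G (S t) \<le> X))" for ts b
  have loop: "runs (for_each R (\<lambda>t. update_best G (S t)) best) (I [])
      (\<Sum>t\<leftarrow>R. 1 + (\<Sum>v\<in>S t. 3 + real (degree G v)))"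
  proof (rule runs_for_each)
    fix t ts b assume I: "I (t # ts) b"
    then have "steiner_cut G T (S t)" "valid_best G T b" using S by (auto simp: I_def)
    from runs_update_best[OF G this, of X]
    show "runs (update_best G (S t) b) (I ts) (\<Sum>v\<in>S t. 3 + real (degree G v))"
      by (rule runs_weaken) (use I in \<open>auto simp: I_def\<close>)
  qed (use assms(6) in \<open>auto simp: I_def good_def\<close>)
  have sub: "S t \<subseteq> verts G" if "t \<in> set R" for t
    using S(1)[OF that] by (auto simp: steiner_cut_def)
  have "(\<Sum>t\<leftarrow>R. 1 + (\<Sum>v\<in>S t. 3 + real (degree G v)))
      = card (set R) + (\<Sum>t\<in>set R. \<Sum>v\<in>S t. 3 + real (degree G v))"
    using R(1) by (simp add: sum_list_distinct_conv_sum_set sum.distrib)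
  also have "(\<Sum>t\<in>set R. \<Sum>v\<in>S t. 3 + real (degree G v)) = (\<Sum>v\<in>(\<Union>t\<in>set R. S t). 3 + real (degree G v))"
    using S(2) finite_subset[OF sub fin]
    by (intro sum.UNION_disjoint[symmetric]) (auto simp: disjoint_family_on_def)
  also have "\<dots> \<le> (\<Sum>v\<in>verts G. 3 + real (degree G v))"
    using sub fin by (intro sum_mono2) auto
  also have "\<dots> = 3 * card (verts G) + 2 * card (edges G)"
    using sum_degree[OF G] by (simp add: sum.distrib flip: of_nat_sum)
  finally have "(\<Sum>t\<leftarrow>R. 1 + (\<Sum>v\<in>S t. 3 + real (degree G v))) \<le> 4 * card (verts G) + 2 * card (edges G)"
    using card_mono[OF fin R(2)] by simp
  then show ?thesis
    by (intro runs_weaken[OF loop]) (auto simp: I_def good_def)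
qed

text \<open>The part of a round after sampling. The subroutine's guarantees hold for every outcome,
  so once the sample isolates a terminal of \<open>A\<close>, success is certain.\<close>

lemma runs_icuts_update:
  fixes icuts :: "'a wgraph \<Rightarrow> 'a set \<Rightarrow> ('a \<Rightarrow> 'a set) timed" and B :: real
  assumes G: "weighted_graph G" "T \<subseteq> verts G"
    and icuts: "\<forall>R. R \<subseteq> verts G \<and> 2 \<le> card R \<longrightarrow> runs (icuts G R) (isolating_cuts_output \<epsilon> G R) B"
    and "0 \<le> B" "0 \<le> \<epsilon>"
    and A: "steiner_cut G T A" "(1 + \<epsilon>) * cut_weight G A \<le> X"
    and R: "distinct R" "set R \<subseteq> T"
    and best: "valid_best G T best"
  shows "runs (if length R < 2 then ret best
      else icuts G (set R) \<bind>\<^sub>t (\<lambda>S. for_each R (\<lambda>t. update_best G (S t)) best))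
    (\<lambda>b. valid_best G T b \<and>
      (best_within X best \<or>
         length (filter (\<lambda>x. x \<in> A) R) = 1 \<and> 1 \<le> length (filter (\<lambda>x. x \<notin> A) R)
       \<longrightarrow> best_within X b))
    (B + (4 * card (verts G) + 2 * card (edges G)))" (is "runs _ (\<lambda>b. _ \<and> (_ \<or> ?good \<longrightarrow> _)) _")
proof (cases "length R < 2")
  case True
  \<comment> \<open>An isolating sample has one element in \<open>A\<close> and another outside it,
    so the early exit never discards one.\<close>
  have "\<not> ?good"
    using sum_length_filter_compl[of "\<lambda>x. x \<in> A" R] True by linarith
  with True best \<open>0 \<le> B\<close> show ?thesis
    by (auto intro!: runs_weaken[OF runs_ret[of "\<lambda>b. b = best"]])
next
  case False
  have RV: "set R \<subseteq> verts G" and card: "2 \<le> card (set R)"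
    using R G(2) False by (auto simp: distinct_card)
  have fin: "finite (verts G)" using G(1) by (simp add: weighted_graph_def)
  have "runs (icuts G (set R) \<bind>\<^sub>t (\<lambda>S. for_each R (\<lambda>t. update_best G (S t)) best))
    (\<lambda>b. valid_best G T b \<and> (best_within X best \<or> ?good \<longrightarrow> best_within X b))
    (B + (4 * card (verts G) + 2 * card (edges G)))"
  proof (rule runs_bind[OF icuts[rule_format, OF conjI[OF RV card]]])
    fix S assume S: "isolating_cuts_output \<epsilon> G (set R) S"
    have app: "approx_min_isolating_cut \<epsilon> G (set R) t (S t)" if "t \<in> set R" for t
      using S that by (simp add: isolating_cuts_output_def)
    have steiner: "steiner_cut G T (S t)" if "t \<in> set R" for t
      using app[OF that] isolating_cut_imp_steiner_cut[OF _ R(2) card]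
      by (auto simp: approx_min_isolating_cut_def)
    have disj: "disjoint_family_on S (set R)"
      using S by (simp add: isolating_cuts_output_def)
    have "\<exists>t\<in>set R. cut_weight G (S t) \<le> X" if good: ?good
    proof -
      from good obtain t where t: "filter (\<lambda>x. x \<in> A) R = [t]"
        by (auto simp: length_Suc_conv)
      then have RA: "set R \<inter> A = {t}" using arg_cong[OF t, of set] unfolding set_filter by auto
      then have iso: "isolating_cut G (set R) t A"
        using A(1) by (auto simp: isolating_cut_def steiner_cut_def)
      have "finite {S'. isolating_cut G (set R) t S'}"
        by (rule finite_subset[of _ "Pow (verts G)"]) (use fin in \<open>auto simp: isolating_cut_def\<close>)
      then have "Min (cut_weight G ` {S'. isolating_cut G (set R) t S'}) \<le> cut_weight G A"
        using iso by (intro Min_le) auto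
      then have "(1 + \<epsilon>) * Min (cut_weight G ` {S'. isolating_cut G (set R) t S'}) \<le> X"
        using \<open>0 \<le> \<epsilon>\<close> A(2) by (intro order_trans[OF mult_left_mono A(2)]) auto
      with app[of t] RA show ?thesis
        by (intro bexI[of _ t]) (force simp: approx_min_isolating_cut_def)+
    qed
    with runs_update_best_loop[OF G(1) R(1) RV steiner disj best, of X]
    show "runs (for_each R (\<lambda>t. update_best G (S t)) best)
      (\<lambda>b. valid_best G T b \<and> (best_within X best \<or> ?good \<longrightarrow> best_within X b))
      (4 * card (verts G) + 2 * card (edges G))"
      by (auto elim!: runs_weaken)
  qed
  with False show ?thesis by simp
qed

text \<open>After sampling nothing is left to chance, so a round misses the threshold at most as
  often as its sample fails to isolate a terminal of \<open>A\<close>.\<close>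

lemma
  fixes icuts :: "'a wgraph \<Rightarrow> 'a set \<Rightarrow> ('a \<Rightarrow> 'a set) timed" and B :: real
  assumes G: "weighted_graph G" "T \<subseteq> verts G"
    and icuts: "\<forall>R. R \<subseteq> verts G \<and> 2 \<le> card R \<longrightarrow> runs (icuts G R) (isolating_cuts_output \<epsilon> G R) B"
    and "0 \<le> B" "0 \<le> \<epsilon>"
    and A: "steiner_cut G T A" "(1 + \<epsilon>) * cut_weight G A \<le> X"
  shows runs_steiner_round: "valid_best G T best \<Longrightarrow>
      runs (steiner_round icuts G T i best)
        (\<lambda>b. valid_best G T b \<and> (best_within X best \<longrightarrow> best_within X b))
        (card T * (1 + real i) + (card T + (B + (4 * card (verts G) + 2 * card (edges G)))))"
    and prob_steiner_round: "valid_best G T best \<Longrightarrow>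
      measure_pmf.prob (run (steiner_round icuts G T i best)) {b. \<not> best_within X b}
      \<le> measure_pmf.prob (run (sample_terminals i T))
          {R. \<not> (length (filter (\<lambda>x. x \<in> A) R) = 1 \<and> 1 \<le> length (filter (\<lambda>x. x \<notin> A) R))}"
proof -
  assume best: "valid_best G T best"
  have finT: "finite T" using G finite_subset by (auto simp: weighted_graph_def)
  note upd = runs_icuts_update[where icuts = icuts, OF G icuts \<open>0 \<le> B\<close> \<open>0 \<le> \<epsilon>\<close> A _ _ best]
  show "runs (steiner_round icuts G T i best)
        (\<lambda>b. valid_best G T b \<and> (best_within X best \<longrightarrow> best_within X b))
        (card T * (1 + real i) + (card T + (B + (4 * card (verts G) + 2 * card (edges G)))))"
    unfolding steiner_round_def
  proof (rule runs_bind[OF runs_sample_terminals[OF finT]], elim conjE)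
    fix R assume R: "distinct R" "set R \<subseteq> T"
    then have "length R \<le> card T"
      using card_mono[OF finT] by (simp flip: distinct_card)
    then show "runs (tick (length R) \<bind>\<^sub>t (\<lambda>_. if length R < 2 then ret best
        else icuts G (set R) \<bind>\<^sub>t (\<lambda>S. for_each R (\<lambda>t. update_best G (S t)) best)))
      (\<lambda>b. valid_best G T b \<and> (best_within X best \<longrightarrow> best_within X b))
      (card T + (B + (4 * card (verts G) + 2 * card (edges G))))"
      by (intro runs_bind[OF runs_weaken[OF runs_tick]] runs_weaken[OF upd[OF R]]) auto
  qed
  let ?isolated = "\<lambda>R. length (filter (\<lambda>x. x \<in> A) R) = 1 \<and> 1 \<le> length (filter (\<lambda>x. x \<notin> A) R)"
  define rest where "rest R = (if length R < 2 then ret best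
    else icuts G (set R) \<bind>\<^sub>t (\<lambda>S. for_each R (\<lambda>t. update_best G (S t)) best))" for R
  have "run (steiner_round icuts G T i best) = bind_pmf (run (sample_terminals i T)) (\<lambda>R. run (rest R))"
    by (simp add: steiner_round_def rest_def bind_return_pmf)
  moreover have "measure_pmf.prob (bind_pmf (run (sample_terminals i T)) (\<lambda>R. run (rest R))) {b. \<not> best_within X b}
      \<le> measure_pmf.prob (run (sample_terminals i T)) {R. \<not> ?isolated R} * 1"
  proof (rule measure_bind_pmf_le)
    fix R assume "R \<in> set_pmf (run (sample_terminals i T))"
    from runs_run[OF runs_sample_terminals[OF finT] this]
    have "distinct R" "set R \<subseteq> T" by auto
    from runs_run[OF upd[OF this], folded rest_def]
    have "measure_pmf.prob (run (rest R)) {b. \<not> best_within X b} = 0" if "?isolated R"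
      using that by (subst measure_pmf_zero_iff) auto
    then show "measure_pmf.prob (run (rest R)) {b. \<not> best_within X b}
        \<le> (if R \<in> {R. \<not> ?isolated R} then 1 else 0)"
      by auto
  qed simp
  ultimately show "measure_pmf.prob (run (steiner_round icuts G T i best)) {b. \<not> best_within X b}
      \<le> measure_pmf.prob (run (sample_terminals i T)) {R. \<not> ?isolated R}"
    by simp
qed

lemma finite_steiner_cuts: "finite (verts G) \<Longrightarrow> finite {S. steiner_cut G T S}"
  by (rule finite_subset[of _ "Pow (verts G)"]) (auto simp: steiner_cut_def)

text \<open>A singleton terminal shows that Steiner cuts exist. A minimum one may be replaced by its
  complement, which has the same weight, to get the balance required by
  \<open>isolation_probability\<close>.\<close>

lemma obtain_min_steiner_cut:
  assumes "weighted_graph G" "T \<subseteq> verts G" "2 \<le> card T"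
  obtains A where "steiner_cut G T A"
    "cut_weight G A = Min (cut_weight G ` {S. steiner_cut G T S})"
    "card {x \<in> T. x \<in> A} \<le> card {x \<in> T. x \<notin> A}"
proof -
  have fin: "finite (verts G)" using assms(1) by (simp add: weighted_graph_def)
  have "T \<noteq> {}" "\<And>t. T \<noteq> {t}" using assms(3) by auto
  then obtain t where "t \<in> T" "T \<noteq> {t}" by blast
  then have "steiner_cut G T {t}" using assms(2) by (auto simp: steiner_cut_def)
  then have "{S. steiner_cut G T S} \<noteq> {}" by blast
  then have "Min (cut_weight G ` {S. steiner_cut G T S}) \<in> cut_weight G ` {S. steiner_cut G T S}"
    using finite_steiner_cuts[OF fin] by (intro Min_in) auto
  then obtain A where A: "steiner_cut G T A"
    "cut_weight G A = Min (cut_weight G ` {S. steiner_cut G T S})" by force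
  show ?thesis
  proof (cases "card {x \<in> T. x \<in> A} \<le> card {x \<in> T. x \<notin> A}")
    case True
    with A show ?thesis by (rule that)
  next
    case False
    have "{x \<in> T. x \<in> verts G - A} = {x \<in> T. x \<notin> A}" "{x \<in> T. x \<notin> verts G - A} = {x \<in> T. x \<in> A}"
      using assms(2) by auto
    moreover have "cut_weight G (verts G - A) = cut_weight G A"
      using A(1) by (intro cut_weight_complement) (auto simp: steiner_cut_def)
    ultimately show ?thesis
      using False A steiner_cut_complement[OF assms(2) A(1)] by (intro that[of "verts G - A"]) auto
  qed
qed

section \<open>Success probability of the algorithm\<close>

lemma prob_approx_steiner_cut_alg:
  fixes icuts :: "'a wgraph \<Rightarrow> 'a set \<Rightarrow> ('a \<Rightarrow> 'a set) timed" and B :: real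
  assumes G: "weighted_graph G" "T \<subseteq> verts G" "2 \<le> card T"
    and icuts: "\<forall>R. R \<subseteq> verts G \<and> 2 \<le> card R \<longrightarrow> runs (icuts G R) (isolating_cuts_output \<epsilon> G R) B"
    and "0 \<le> B" "0 \<le> \<epsilon>"
  shows "1 - 1 / real (card (verts G)) \<le> measure_pmf.prob (approx_steiner_cut_alg icuts G T)
    {(out, time). \<exists>S. out = Some S \<and> approx_min_steiner_cut \<epsilon> G T S}"
proof -
  define n where "n = card (verts G)"
  define I where "I = nat \<lceil>log 2 (real (card T))\<rceil>"
  define J where "J = nat \<lceil>log (8 / 7) (real n)\<rceil>"
  have fin: "finite (verts G)" "finite T" using G finite_subset by (auto simp: weighted_graph_def)
  have n: "2 \<le> n" using card_mono[OF fin(1) G(2)] G(3) by (simp add: n_def)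
  obtain A where A: "steiner_cut G T A" "cut_weight G A = Min (cut_weight G ` {S. steiner_cut G T S})"
    "card {x \<in> T. x \<in> A} \<le> card {x \<in> T. x \<notin> A}"
    using obtain_min_steiner_cut[OF G] .
  define X where "X = (1 + \<epsilon>) * cut_weight G A"
  have "{x \<in> T. x \<in> A} \<noteq> {}" using A(1) by (auto simp: steiner_cut_def)
  then have a: "1 \<le> card {x \<in> T. x \<in> A}" using fin(2) by (simp add: Suc_le_eq card_gt_0_iff)
  obtain i0 where i0: "1 \<le> i0" "2 ^ i0 \<le> card {x \<in> T. x \<in> A} + card {x \<in> T. x \<notin> A}"
    and "1 / 8 \<le> real (card {x \<in> T. x \<in> A}) * (1 / 2 ^ i0) *
      (1 - 1 / 2 ^ i0) ^ (card {x \<in> T. x \<in> A} - 1) * (1 - (1 - 1 / 2 ^ i0) ^ card {x \<in> T. x \<notin> A})"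
    using isolation_probability[OF a A(3)] .
  note sample = prob_sample_terminals_isolates[OF fin(2) a this(3)]
  have "card {x \<in> T. x \<in> A} + card {x \<in> T. x \<notin> A} = card T"
    using fin(2) by (subst card_Un_disjoint[symmetric]) (auto intro!: arg_cong[where f = card])
  with i0(2) have "2 ^ i0 \<le> card T" by simp
  \<comment> \<open>The good scale is among those tried by the outer loop.\<close>
  then have "real i0 \<le> log 2 (card T)"
    by (intro le_log2_of_power) simp
  then have i0I: "i0 \<le> I" unfolding I_def by linarith
  note round = G(1,2) icuts \<open>0 \<le> B\<close> \<open>0 \<le> \<epsilon>\<close> A(1) eq_refl[OF X_def[symmetric]]
  \<comment> \<open>Only the rounds at scale \<open>i0\<close> are credited with a chance of
    success; the others merely must not lose what was found.\<close>
  define q where "q i = (if i = i0 then (7 / 8 :: real) else 1)" for i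
  have step: "progress (valid_best G T) (best_within X) (q i) (\<lambda>s. run (steiner_round icuts G T i s))" for i
    unfolding progress_def
  proof (intro allI impI conjI ballI)
    fix s s' assume s: "valid_best G T s"
    show "measure_pmf.prob (run (steiner_round icuts G T i s)) {s. \<not> best_within X s} \<le> q i"
    proof (cases "i = i0")
      case True
      then show ?thesis
        using order_trans[OF prob_steiner_round[where icuts = icuts, OF round s] sample] by (simp add: q_def)
    qed (simp add: q_def)
    assume "s' \<in> set_pmf (run (steiner_round icuts G T i s))"
    from runs_run[OF runs_steiner_round[where icuts = icuts, OF round s] this]
    show "valid_best G T s'" "best_within X s \<Longrightarrow> best_within X s'" by auto
  qed
  define loop where "loop = for_each [1..<I + 1] (\<lambda>i. for_each [1..<J + 1] (\<lambda>j. steiner_round icuts G T i)) None"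
  have "progress (valid_best G T) (best_within X) (q i ^ J)
      (\<lambda>s. run (for_each [1..<J + 1] (\<lambda>j. steiner_round icuts G T i) s))" for i
  proof -
    have "progress (valid_best G T) (best_within X) (prod_list (map (\<lambda>j. q i) [1..<J + 1]))
        (\<lambda>s. run (for_each [1..<J + 1] (\<lambda>j. steiner_round icuts G T i) s))"
      by (rule progress_for_each[OF step]) (simp add: q_def)
    then show ?thesis by (simp only: map_replicate_const prod_list_replicate length_upt) simp
  qed
  then have "progress (valid_best G T) (best_within X) (prod_list (map (\<lambda>i. q i ^ J) [1..<I + 1]))
      (\<lambda>s. run (for_each [1..<I + 1] (\<lambda>i. for_each [1..<J + 1] (\<lambda>j. steiner_round icuts G T i)) s))"
    by (rule progress_for_each) (simp add: q_def)
  moreover have "prod_list (map (\<lambda>i. q i ^ J) [1..<I + 1]) = (7 / 8) ^ J"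
  proof -
    have "prod_list (map (\<lambda>i. q i ^ J) [1..<I + 1]) = (\<Prod>i\<in>{1..<I + 1}. q i ^ J)"
      by (simp only: prod.distinct_set_conv_list[OF distinct_upt, symmetric] set_upt)
    also have "\<dots> = (\<Prod>i\<in>{1..<I + 1}. if i = i0 then (7 / 8) ^ J else 1)"
      by (intro prod.cong) (auto simp: q_def)
    also have "\<dots> = (7 / 8) ^ J" using i0 i0I by simp
    finally show ?thesis .
  qed
  moreover have none: "valid_best G T None" by (simp add: valid_best_def)
  ultimately have loop: "\<And>s. s \<in> set_pmf (run loop) \<Longrightarrow> valid_best G T s"
    "measure_pmf.prob (run loop) {s. \<not> best_within X s} \<le> (7 / 8) ^ J"
    using none unfolding progress_def loop_def by metis+
  \<comment> \<open>The base 8/7 of the repetition count matches the failure probability 7/8 of a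
    round.\<close>
  have "real n = (8 / 7) powr log (8 / 7) (real n)" using n by simp
  also have "\<dots> \<le> (8 / 7) powr real J" unfolding J_def by (intro powr_mono) linarith+
  also have "\<dots> = (8 / 7) ^ J" by (simp add: powr_realpow)
  finally have J: "(7 / 8) ^ J \<le> 1 / real n" using n by (simp add: field_simps)
  let ?good = "{out. \<exists>S. out = Some S \<and> approx_min_steiner_cut \<epsilon> G T S}"
  have alg: "run (approx_steiner_cut_alg icuts G T) = map_pmf (map_option fst) (run loop)"
    by (simp add: approx_steiner_cut_alg_def Let_def bind_return_pmf loop_def I_def J_def n_def
        map_pmf_def)
  have "1 - 1 / real n \<le> 1 - measure_pmf.prob (run loop) {s. \<not> best_within X s}"
    using loop(2) J by simp
  also have "\<dots> = measure_pmf.prob (run loop) {s. best_within X s}"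
    by (subst measure_pmf.prob_compl[symmetric]) (auto intro!: arg_cong[where f = "measure_pmf.prob _"])
  also have "\<dots> \<le> measure_pmf.prob (run loop) (map_option fst -` ?good)"
  \<comment> \<open>The inclusion is needed on the support only, where the stored weight is known to
    be the true cut weight.\<close>
  proof (rule measure_pmf.finite_measure_mono_AE)
    show "AE s in run loop. s \<in> {s. best_within X s} \<longrightarrow> s \<in> map_option fst -` ?good"
    proof (rule AE_pmfI, rule impI)
      fix s assume s: "s \<in> set_pmf (run loop)" "s \<in> {s. best_within X s}"
      then obtain S d where S: "s = Some (S, d)" "d \<le> X" by (auto simp: best_within_def)
      with loop(1)[OF s(1)] have "steiner_cut G T S" "cut_weight G S \<le> X" by (auto simp: valid_best_def)
      with S(1) A(2) show "s \<in> map_option fst -` ?good"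
        by (auto simp: approx_min_steiner_cut_def X_def)
    qed
  qed simp
  also have "\<dots> = measure_pmf.prob (run (approx_steiner_cut_alg icuts G T)) ?good"
    by (simp add: alg)
  also have "\<dots> = measure_pmf.prob (approx_steiner_cut_alg icuts G T) (fst -` ?good)"
    by (simp add: run_def)
  also have "fst -` ?good = {(out, time). \<exists>S. out = Some S \<and> approx_min_steiner_cut \<epsilon> G T S}"
    by auto
  finally show ?thesis by (simp add: n_def)
qed

section \<open>Running time of the algorithm\<close>

text \<open>There are O(L^2) rounds, L being log n in base 2, and each costs O(N L^(k+1)) with N = m
  + n; this gives the exponent k + 3.\<close>

lemma time_approx_steiner_cut_alg:
  fixes icuts :: "'a wgraph \<Rightarrow> 'a set \<Rightarrow> ('a \<Rightarrow> 'a set) timed" and B :: real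
  assumes G: "weighted_graph G" "T \<subseteq> verts G" "2 \<le> card T"
    and icuts: "\<forall>R. R \<subseteq> verts G \<and> 2 \<le> card R \<longrightarrow> runs (icuts G R) (isolating_cuts_output \<epsilon> G R)
      (C * real (card (edges G) + card (verts G)) * log 2 (card (verts G)) ^ k)"
    and "0 \<le> C" "0 \<le> \<epsilon>"
  shows "runs (approx_steiner_cut_alg icuts G T) (\<lambda>_. True)
    ((140 + 14 * C) * real (card (edges G) + card (verts G)) * log 2 (card (verts G)) ^ (k + 3))"
proof -
  define n where "n = card (verts G)"
  define N where "N = real (card (edges G) + n)"
  define L where "L = log 2 (real n)"
  define I where "I = nat \<lceil>log 2 (real (card T))\<rceil>"
  define J where "J = nat \<lceil>log (8 / 7) (real n)\<rceil>"
  define B where "B = C * N * L ^ k"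
  define W where "W = n * (1 + real I) + (n + (B + (4 * n + 2 * card (edges G))))"
  have fin: "finite (verts G)" "finite T" using G finite_subset by (auto simp: weighted_graph_def)
  have Tn: "card T \<le> n" using card_mono[OF fin(1) G(2)] by (simp add: n_def)
  then have n: "2 \<le> n" using G(3) by simp
  have L: "1 \<le> L" using n by (simp add: L_def)
  have N: "1 \<le> N" "n \<le> N" using n by (auto simp: N_def)
  have B: "0 \<le> B" using \<open>0 \<le> C\<close> N L by (simp add: B_def)
  obtain A where A: "steiner_cut G T A" using obtain_min_steiner_cut[OF G] by blast
  define X where "X = (1 + \<epsilon>) * cut_weight G A"
  note round = runs_steiner_round[where icuts = icuts, OF G(1,2) icuts[folded n_def, folded N_def L_def, folded B_def]
      B \<open>0 \<le> \<epsilon>\<close> A eq_refl[OF X_def[symmetric]]]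
  have loop: "runs (for_each [1..<I + 1] (\<lambda>i. for_each [1..<J + 1] (\<lambda>j. steiner_round icuts G T i)) None)
    (\<lambda>s. set [] \<subseteq> {..I} \<and> valid_best G T s) (\<Sum>i\<leftarrow>[1..<I + 1]. 1 + (\<Sum>j\<leftarrow>[1..<J + 1]. 1 + W))"
  \<comment> \<open>The remaining scales are tracked in the invariant to bound the cost i of a coin
    by \<open>I\<close>.\<close>
  proof (rule runs_for_each[where I = "\<lambda>is s. set is \<subseteq> {..I} \<and> valid_best G T s"])
    fix i "is" s assume i: "set (i # is) \<subseteq> {..I} \<and> valid_best G T s"
    have "runs (for_each [1..<J + 1] (\<lambda>j. steiner_round icuts G T i) s) (valid_best G T)
      (\<Sum>j\<leftarrow>[1..<J + 1]. 1 + W)"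
    proof (rule runs_for_each[where I = "\<lambda>_. valid_best G T"])
      fix s assume s: "valid_best G T s"
      have "card T * (1 + real i) \<le> n * (1 + real I)"
        using i Tn by (intro mult_mono) auto
      then show "runs (steiner_round icuts G T i s) (valid_best G T) W"
        using Tn by (intro runs_weaken[OF round[OF s]]) (auto simp: W_def n_def)
    qed (use i in simp)
    then show "runs (for_each [1..<J + 1] (\<lambda>j. steiner_round icuts G T i) s)
      (\<lambda>s. set is \<subseteq> {..I} \<and> valid_best G T s) (\<Sum>j\<leftarrow>[1..<J + 1]. 1 + W)"
      by (rule runs_weaken) (use i in auto)
  qed (auto simp: valid_best_def)
  have "runs (approx_steiner_cut_alg icuts G T) (\<lambda>_. True)
    (real (n + card T + I + J) +
      ((\<Sum>i\<leftarrow>[1..<I + 1]. 1 + (\<Sum>j\<leftarrow>[1..<J + 1]. 1 + W)) + (real n + 0)))"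
    unfolding approx_steiner_cut_alg_def Let_def n_def[symmetric] I_def[symmetric] J_def[symmetric]
    by (intro runs_bind[OF runs_tick] runs_bind[OF loop] runs_ret) auto
  then show ?thesis
    unfolding n_def[symmetric] N_def[symmetric] L_def[symmetric]
  proof (rule runs_weaken)
    have "log 2 (real (card T)) \<le> L" unfolding L_def using Tn G(3) by simp
    \<comment> \<open>Rounding up costs at most 1, which is at most \<open>L\<close>.\<close>
    then have I: "real I \<le> 2 * L" using L unfolding I_def by linarith
    have "log (8 / 7) (real n) = L * log (8 / 7) 2"
      using n by (simp add: L_def log_def)
    \<comment> \<open>Indeed (8/7)^6 = 262144/117649 > 2.\<close>
    also have "log (8 / 7) 2 \<le> (6 :: real)"
      by (subst log_le_iff) (auto simp: powr_numeral power_divide)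
    then have "L * log (8 / 7) 2 \<le> L * 6" using L by (intro mult_left_mono) auto
    finally have J: "real J \<le> 7 * L" using L unfolding J_def by linarith
    define Z where "Z = N * L ^ (k + 3)"
    have "L \<le> L ^ (k + 3)" "L\<^sup>2 \<le> L ^ (k + 3)" "1 \<le> L ^ (k + 3)"
      using L power_increasing[of 1 "k + 3" L] power_increasing[of 2 "k + 3" L] by auto
    moreover have "L ^ (k + 3) \<le> Z" "N * 1 \<le> Z"
      using N L mult_right_mono[of 1 N "L ^ (k + 3)"] unfolding Z_def by (auto intro!: mult_left_mono)
    ultimately have Z: "N \<le> Z" "L \<le> Z" "L\<^sup>2 \<le> Z" by linarith+
    have Lk: "L ^ k \<le> L ^ (k + 1)" "L \<le> L ^ (k + 1)" "1 \<le> L ^ (k + 1)"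
      using L power_increasing[of 1 "k + 1" L] power_increasing[of k "k + 1" L] one_le_power[of L "k + 1"]
      by (auto simp del: power_Suc)
    have "W \<le> N * (1 + 2 * L) + (N + (C * N * L ^ k + 4 * N))"
    proof -
      have "n * (1 + real I) \<le> N * (1 + 2 * L)" using N I by (intro mult_mono) auto
      then show ?thesis using N unfolding W_def B_def N_def by auto
    qed
    also have "\<dots> = N * (6 + 2 * L + C * L ^ k)" by (simp add: algebra_simps)
    also have "\<dots> \<le> N * (6 * L ^ (k + 1) + 2 * L ^ (k + 1) + C * L ^ (k + 1))"
      using N Lk \<open>0 \<le> C\<close> by (intro mult_left_mono add_mono mult_left_mono) auto
    finally have W: "W \<le> (8 + C) * (N * L ^ (k + 1))" by (simp add: algebra_simps)
    have W0: "0 \<le> W" using B by (simp add: W_def)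
    have IJ: "real I * real J \<le> 14 * L\<^sup>2"
      using mult_mono[OF I J] L by (simp add: power2_eq_square)
    have "real I * real J * W \<le> 14 * L\<^sup>2 * ((8 + C) * (N * L ^ (k + 1)))"
      by (rule mult_mono[OF IJ W]) (use W0 in auto)
    also have "\<dots> = (112 + 14 * C) * Z"
      by (simp add: Z_def power_add power2_eq_square power3_eq_cube algebra_simps)
    finally have IJW: "real I * real J * W \<le> (112 + 14 * C) * Z" .
    have "real (n + card T + I + J) + ((\<Sum>i\<leftarrow>[1..<I + 1]. 1 + (\<Sum>j\<leftarrow>[1..<J + 1]. 1 + W)) + (real n + 0))
      = 2 * real n + card T + 2 * real I + real J + real I * real J + real I * real J * W"
      by (simp only: sum_list_triv length_upt) (simp add: algebra_simps)
    \<comment> \<open>The summands bound, in order, 2n + |T|, 2I, J, IJ and the cost of all rounds;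
      3 + 4 + 7 + 14 + 112 = 140.\<close>
    also have "\<dots> \<le> 3 * Z + 4 * Z + 7 * Z + 14 * Z + (112 + 14 * C) * Z"
      using Tn N I J IJ IJW Z by linarith
    also have "\<dots> = (140 + 14 * C) * N * L ^ (k + 3)"
      by (simp add: Z_def algebra_simps)
    finally show "real (n + card T + I + J) + ((\<Sum>i\<leftarrow>[1..<I + 1]. 1 + (\<Sum>j\<leftarrow>[1..<J + 1]. 1 + W)) + (real n + 0))
      \<le> (140 + 14 * C) * N * L ^ (k + 3)" .
  qed simp
qed

text \<open>The constants \<open>K\<close> and \<open>l\<close> are fixed before the graph and the
  terminals. The bound in m alone covers every graph without isolated vertices, as these satisfy n
  <= 2m.\<close>

theorem theorem6p6:
  fixes \<epsilon> :: real and c :: nat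
    and icuts :: "'a wgraph \<Rightarrow> 'a set \<Rightarrow> ('a \<Rightarrow> 'a set) timed"
  assumes "0 < \<epsilon>" and "\<epsilon> < 1"
    and "isolating_cuts_subroutine \<epsilon> c icuts"
  shows "\<exists>K l. \<forall>G T.
    weighted_graph G \<and> weight_ratio_le_poly c G \<and> T \<subseteq> verts G \<and> card T \<ge> 2 \<longrightarrow>
      measure_pmf.prob (approx_steiner_cut_alg icuts G T)
        {(out, time). \<exists>S. out = Some S \<and> approx_min_steiner_cut \<epsilon> G T S}
        \<ge> 1 - 1 / real (card (verts G)) \<and>
      (\<forall>(out, time)\<in>set_pmf (approx_steiner_cut_alg icuts G T).
        real time \<le> K * real (card (edges G) + card (verts G))
                      * log 2 (real (card (verts G))) ^ l \<and>
        (card (verts G) \<le> 2 * card (edges G) \<longrightarrow>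
          real time \<le> K * real (card (edges G)) * log 2 (real (card (verts G))) ^ l))"
proof -
  obtain C k where "\<forall>G R. weighted_graph G \<and> weight_ratio_le_poly c G \<and> R \<subseteq> verts G \<and> card R \<ge> 2 \<longrightarrow>
      runs (icuts G R) (isolating_cuts_output \<epsilon> G R)
        (C * real (card (edges G) + card (verts G)) * log 2 (real (card (verts G))) ^ k / \<epsilon> ^ 3)"
    using assms(3) unfolding isolating_cuts_subroutine_def runs_def by (elim exE)
  note sub = this[rule_format, OF conjI[OF _ conjI[OF _ conjI]]]
  \<comment> \<open>The absolute value makes the constant nonnegative; the factor 1/\<epsilon>^3 is
    constant and absorbed here.\<close>
  define C' where "C' = \<bar>C\<bar> / \<epsilon> ^ 3"
  \<comment> \<open>The factor 3 pays for m + n <= 3m when n <= 2m.\<close>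
  define K where "K = 3 * (140 + 14 * C')"
  have C': "0 \<le> C'" using assms(1) by (simp add: C'_def)
  show ?thesis
  proof (intro exI[of _ K] exI[of _ "k + 3"] allI impI, elim conjE)
    fix G :: "'a wgraph" and T
    assume G: "weighted_graph G" "weight_ratio_le_poly c G" "T \<subseteq> verts G" "2 \<le> card T"
    define n where "n = card (verts G)"
    define m where "m = card (edges G)"
    define L where "L = log 2 (real n)"
    have "card T \<le> n" using G by (auto simp: n_def weighted_graph_def intro: card_mono)
    then have n: "2 \<le> n" using G(4) by simp
    have L: "1 \<le> L" using n by (simp add: L_def)
    have icuts: "\<forall>R. R \<subseteq> verts G \<and> 2 \<le> card R \<longrightarrow>
      runs (icuts G R) (isolating_cuts_output \<epsilon> G R) (C' * real (m + n) * L ^ k)"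
    proof (intro allI impI, elim conjE, rule runs_weaken[OF sub[OF G(1,2)]])
      have "C * (real (m + n) * L ^ k / \<epsilon> ^ 3) \<le> \<bar>C\<bar> * (real (m + n) * L ^ k / \<epsilon> ^ 3)"
        using assms(1) L by (intro mult_right_mono) auto
      then show "C * real (card (edges G) + card (verts G)) * log 2 (real (card (verts G))) ^ k / \<epsilon> ^ 3
          \<le> C' * real (m + n) * L ^ k"
        by (simp add: C'_def m_def n_def L_def)
    qed
    have B: "0 \<le> C' * real (m + n) * L ^ k" using C' L by (intro mult_nonneg_nonneg) auto
    have time: "runs (approx_steiner_cut_alg icuts G T) (\<lambda>_. True)
        ((140 + 14 * C') * real (m + n) * L ^ (k + 3))"
      using time_approx_steiner_cut_alg[where icuts = icuts, OF G(1,3,4)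
          icuts[unfolded m_def n_def L_def] C' less_imp_le[OF assms(1)]]
      unfolding m_def n_def L_def .
    have K: "(140 + 14 * C') * real (m + n) * L ^ (k + 3) \<le> K * x * L ^ (k + 3)"
      if "real (m + n) \<le> 3 * x" for x
    proof -
      have "(140 + 14 * C') * real (m + n) \<le> (140 + 14 * C') * (3 * x)"
        using that C' by (intro mult_left_mono) auto
      then show ?thesis using L by (intro mult_right_mono) (simp_all add: K_def algebra_simps)
    qed
    show "1 - 1 / real (card (verts G)) \<le> measure_pmf.prob (approx_steiner_cut_alg icuts G T)
        {(out, time). \<exists>S. out = Some S \<and> approx_min_steiner_cut \<epsilon> G T S} \<and>
      (\<forall>(out, time)\<in>set_pmf (approx_steiner_cut_alg icuts G T).
        real time \<le> K * real (card (edges G) + card (verts G))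
                      * log 2 (real (card (verts G))) ^ (k + 3) \<and>
        (card (verts G) \<le> 2 * card (edges G) \<longrightarrow>
          real time \<le> K * real (card (edges G)) * log 2 (real (card (verts G))) ^ (k + 3)))"
    proof
      show "1 - 1 / real (card (verts G)) \<le> measure_pmf.prob (approx_steiner_cut_alg icuts G T)
        {(out, time). \<exists>S. out = Some S \<and> approx_min_steiner_cut \<epsilon> G T S}"
        by (rule prob_approx_steiner_cut_alg[where icuts = icuts, OF G(1,3,4) icuts B less_imp_le[OF assms(1)]])
      show "\<forall>(out, time)\<in>set_pmf (approx_steiner_cut_alg icuts G T).
        real time \<le> K * real (card (edges G) + card (verts G))
                      * log 2 (real (card (verts G))) ^ (k + 3) \<and>
        (card (verts G) \<le> 2 * card (edges G) \<longrightarrow>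
          real time \<le> K * real (card (edges G)) * log 2 (real (card (verts G))) ^ (k + 3))"
        unfolding m_def[symmetric] n_def[symmetric] L_def[symmetric]
      proof (intro ballI, clarify, intro conjI impI)
        fix out t assume "(out, t) \<in> set_pmf (approx_steiner_cut_alg icuts G T)"
        with time have t: "real t \<le> (140 + 14 * C') * real (m + n) * L ^ (k + 3)"
          unfolding runs_def by blast
        also have "\<dots> \<le> K * real (m + n) * L ^ (k + 3)" by (rule K) simp
        finally show "real t \<le> K * real (m + n) * L ^ (k + 3)" .
        assume "n \<le> 2 * m"
        then have "(140 + 14 * C') * real (m + n) * L ^ (k + 3) \<le> K * real m * L ^ (k + 3)"
          by (intro K) simp
        with t show "real t \<le> K * real m * L ^ (k + 3)" by (rule order_trans)
      qed
    qed
  qed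
qed

end
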